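(* Let $X$ be a real Banach space, let $g:X^*\to(-\infty,+\infty]$ be a proper convex weak$^*$-lower semicontinuous function, and let $T:X^*\to2^X$ be a set-valued operator with $\mathrm{Gr}\,T\subset\mathrm{Gr}\,\partial g$, i.e. $T(x^* )\subset\partial g(x^* )\cap X$ for all $x^*$. Let $x_0^*\in D(T)$ and define $$h(x^* )=\sup\Big\{\sum_{i=0}^{n-1}\langle x_i,x_{i+1}^*-x_i^*\rangle+\langle x_n,x^*-x_n^*\rangle\Big\},\quad x^*\in X^*,$$ the supremum being over all integers $n\ge0$, all $x_1^*,\dots,x_n^*\in X^*$ and all $x_i\in T(x_i^* )$, $i=0,\dots,n$. Then: (i) if $\operatorname{int}(\operatorname{dom} g)\ne\emptyset$ and $D(T)$ is dense in $\operatorname{int}(\operatorname{dom} g)$, then $g(x^* )-g(x_0^* )=h(x^* )$ for all $x^*\in\operatorname{dom} g$; (ii) if $\operatorname{int}(\operatorname{dom}(g^*|_X))\ne\emptyset$ and $\operatorname{Im}T=\bigcup_{x^*}T(x^* )$ is dense in $\operatorname{int}(\operatorname{dom}(g^*|_X))$, then $g(x^* )-g(x_0^* )=h(x^* )$ for all $x^*\in X^*$.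
   Context: $X$ is identified with its canonical image in $X^{**}$; $\partial g(x^* )\cap X=\{x\in X:\langle y^*-x^*,x\rangle\le g(y^* )-g(x^* )\ \forall y^*\in X^*\}$ for $x^*\in\operatorname{dom} g=\{g<+\infty\}$. $D(T)=\{x^*:T(x^* )\ne\emptyset\}$, $\mathrm{Gr}\,T=\{(x^*,x):x\in T(x^* )\}$. $g^*|_X(x)=\sup_{x^*\in X^*}(\langle x^*,x\rangle-g(x^* ))$ for $x\in X$. Interiors and density are with respect to the norm topologies of $X^*$ and $X$ respectively. *)

theory Defs
  imports "HOL-Analysis.Analysis"
begin

definition weak_star_open :: "('a::real_normed_vector \<Rightarrow>\<^sub>L real) set \<Rightarrow> bool" where
  "weak_star_open U \<longleftrightarrow> (\<forall>p\<in>U. \<exists>F e. finite F \<and> e > 0 \<and>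
      {q. \<forall>x\<in>F. \<bar>blinfun_apply q x - blinfun_apply p x\<bar> < e} \<subseteq> U)"

definition weak_star_lsc :: "('a::real_normed_vector \<Rightarrow>\<^sub>L real \<Rightarrow> ereal) \<Rightarrow> bool" where
  "weak_star_lsc g \<longleftrightarrow> (\<forall>c::ereal. weak_star_open (- {q. g q \<le> c}))"

definition proper_fun :: "('b \<Rightarrow> ereal) \<Rightarrow> bool" where
  "proper_fun g \<longleftrightarrow> (\<forall>x. g x \<noteq> -\<infinity>) \<and> (\<exists>x. g x < \<infinity>)"

definition convex_efun :: "('b::real_vector \<Rightarrow> ereal) \<Rightarrow> bool" where
  "convex_efun g \<longleftrightarrow> (\<forall>x y t. 0 < t \<and> t < 1 \<longrightarrow>
      g (t *\<^sub>R x + (1 - t) *\<^sub>R y) \<le> ereal t * g x + ereal (1 - t) * g y)"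

definition edom :: "('b \<Rightarrow> ereal) \<Rightarrow> 'b set" where
  "edom g = {x. g x < \<infinity>}"

text \<open>\<open>subdiff_X g p\<close> is \<open>\<partial>g(p) \<inter> X\<close>; empty outside dom g.\<close>
definition subdiff_X :: "('a::real_normed_vector \<Rightarrow>\<^sub>L real \<Rightarrow> ereal) \<Rightarrow> ('a \<Rightarrow>\<^sub>L real) \<Rightarrow> 'a set" where
  "subdiff_X g p = {x. g p < \<infinity> \<and>
      (\<forall>q. ereal (blinfun_apply (q - p) x) \<le> g q - g p)}"

definition conj_X :: "('a::real_normed_vector \<Rightarrow>\<^sub>L real \<Rightarrow> ereal) \<Rightarrow> 'a \<Rightarrow> ereal" where
  "conj_X g x = (SUP q. ereal (blinfun_apply q x) - g q)"

definition opdom :: "('b \<Rightarrow> 'c set) \<Rightarrow> 'b set" where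
  "opdom T = {p. T p \<noteq> {}}"

definition chain_fun ::
  "(('a::real_normed_vector \<Rightarrow>\<^sub>L real) \<Rightarrow> 'a set) \<Rightarrow> ('a \<Rightarrow>\<^sub>L real) \<Rightarrow> ('a \<Rightarrow>\<^sub>L real) \<Rightarrow> ereal" where
  "chain_fun T p0 p = Sup {ereal ((\<Sum>i<n. blinfun_apply (ps (Suc i) - ps i) (xs i))
                                   + blinfun_apply (p - ps n) (xs n))
        | n ps xs. ps 0 = p0 \<and> (\<forall>i\<le>n. xs i \<in> T (ps i))}"

end

theory Submission
  imports Defs
begin

text \<open>
  Write \<open>h\<close> for the chain function. Telescoping gives \<open>h \<le> g - g p0\<close>, and appending one more link to a
  chain shows that every \<open>x \<in> T p\<close> is a subgradient of \<open>h\<close> at \<open>p\<close>; so \<open>g\<close> and \<open>h\<close> have common subgradients.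
  The key fact is that two convex lsc functions \<open>F\<close>, \<open>H\<close> on a Banach space with common subgradients on a
  set dense in the interior of \<open>dom F\<close> differ by a constant on \<open>dom F\<close>. By Baire, \<open>F\<close> is bounded above near
  every interior point, so subgradients are bounded near a segment in the interior; choosing base points
  near a subdivision of the segment into \<open>N\<close> equal steps, the increments of \<open>F\<close> and \<open>H\<close> are both
  approximated by the same Riemann-type sum with error \<open>O(1/N)\<close>. Lower semicontinuity together with
  convexity along segments extends the equality to the boundary of the domain.

  Part (i) is the key fact for \<open>g\<close> and \<open>h\<close>. Part (ii) is the key fact for the conjugates of \<open>g\<close> and
  \<open>h\<close> on \<open>X\<close>, followed by the biconjugation of \<open>g\<close>. The latter needs no Hahn-Banach theorem: weak-star lower
  semicontinuity involves finitely many points of \<open>X\<close> only, and the required affine minorant is the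
  derivative of a quadratic penalty in these finitely many coordinates, at the limit of a minimising
  sequence.
\<close>

subsection \<open>Convex functions with common subgradients\<close>

text \<open>Real levels suffice: the sublevel set at infinity is the whole space, and the one at
  minus infinity is an intersection of those at real levels.\<close>

definition norm_lsc :: "('e::topological_space \<Rightarrow> ereal) \<Rightarrow> bool" where
  "norm_lsc F \<longleftrightarrow> (\<forall>c::real. closed {x. F x \<le> ereal c})"

text \<open>The functional lies in the dual of the space on which \<open>F\<close> lives, so one
  notion serves \<open>g\<close> on the dual of X (through \<open>eval_functional\<close>) and the
  conjugates on X.\<close>

definition subgradient :: "('e::real_normed_vector \<Rightarrow> ereal) \<Rightarrow> 'e \<Rightarrow> ('e \<Rightarrow>\<^sub>L real) \<Rightarrow> bool" where
  "subgradient F s \<xi> \<longleftrightarrow> \<bar>F s\<bar> \<noteq> \<infinity> \<and> (\<forall>y. F s + ereal (blinfun_apply \<xi> (y - s)) \<le> F y)"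

lemma norm_lscD:
  fixes F :: "'e::metric_space \<Rightarrow> ereal"
  assumes "norm_lsc F" "ereal c < F a"
  obtains d where "d > 0" "\<And>x. dist x a < d \<Longrightarrow> ereal c < F x"
proof -
  have "open (- {x. F x \<le> ereal c})" using assms(1) by (simp add: norm_lsc_def open_closed)
  then obtain d where "d > 0" "\<forall>x. dist x a < d \<longrightarrow> x \<in> - {x. F x \<le> ereal c}"
    using assms(2) unfolding open_dist by (metis (mono_tags, lifting) ComplI linorder_not_le mem_Collect_eq)
  then show thesis using that[of d] by (auto simp: not_le)
qed

text \<open>Real upper bounds instead of values keep infinities out of later computations; the
  endpoints of the segment are included.\<close>

lemma convex_efun_le:
  assumes "convex_efun F" "F x \<le> ereal A" "F y \<le> ereal B" "0 \<le> t" "t \<le> 1"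
  shows "F ((1 - t) *\<^sub>R x + t *\<^sub>R y) \<le> ereal ((1 - t) * A + t * B)"
proof -
  consider "t = 0" | "t = 1" | "0 < t" "t < 1" using assms(4,5) by linarith
  then show ?thesis
  proof cases
    case 3
    have "F (t *\<^sub>R y + (1 - t) *\<^sub>R x) \<le> ereal t * F y + ereal (1 - t) * F x"
      using assms(1) 3 unfolding convex_efun_def by blast
    also have "\<dots> \<le> ereal t * ereal B + ereal (1 - t) * ereal A"
      using assms(2,3) 3 by (intro add_mono ereal_mult_left_mono) auto
    finally show ?thesis by (simp add: add.commute)
  qed (use assms in auto)
qed

lemma edom_le_real: "x \<in> edom F \<longleftrightarrow> (\<exists>A::real. F x \<le> ereal A)"
  unfolding edom_def by (cases "F x") (auto intro: exI[of _ 0])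

section \<open>Local upper bounds and bounds on subgradients\<close>

text \<open>Shifting both endpoints by the same vector shifts each point of the segment by that
  vector, so the radius does not shrink.\<close>

lemma convex_efun_bounded_tube:
  fixes F :: "'e::real_normed_vector \<Rightarrow> ereal"
  assumes "convex_efun F" "\<And>y. dist y a < r \<Longrightarrow> F y \<le> ereal M" "\<And>y. dist y b < r \<Longrightarrow> F y \<le> ereal M"
    and "0 \<le> t" "t \<le> 1" "dist y ((1 - t) *\<^sub>R a + t *\<^sub>R b) < r"
  shows "F y \<le> ereal M"
proof -
  define u where "u = y - ((1 - t) *\<^sub>R a + t *\<^sub>R b)"
  have u: "norm u < r" using assms(6) by (simp add: u_def dist_norm)
  have "F ((1 - t) *\<^sub>R (a + u) + t *\<^sub>R (b + u)) \<le> ereal ((1 - t) * M + t * M)"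
    using u assms by (intro convex_efun_le assms) (auto simp: dist_norm)
  also have "(1 - t) *\<^sub>R (a + u) + t *\<^sub>R (b + u) = y" by (simp add: u_def algebra_simps)
  finally show ?thesis by (simp add: algebra_simps)
qed

text \<open>Completeness enters here: the closed sublevel sets at natural levels cover the domain,
  so by Baire one of them has interior points.\<close>

lemma norm_lsc_bounded_above_somewhere:
  fixes F :: "'e::banach \<Rightarrow> ereal"
  assumes "norm_lsc F" "interior (edom F) \<noteq> {}"
  obtains z \<rho> n where "\<rho> > 0" "\<And>y. dist y z < \<rho> \<Longrightarrow> F y \<le> ereal n"
proof -
  define G where "G = (\<lambda>n::nat. {x. F x \<le> ereal (real n)})"
  have "edom F \<subseteq> \<Union> (range G)"
  proof
    fix x assume "x \<in> edom F"
    then obtain A where "F x \<le> ereal A" unfolding edom_le_real ..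
    moreover obtain n :: nat where "A \<le> real n" using real_arch_simple by blast
    ultimately have "F x \<le> ereal (real n)" using order_trans[of "F x" "ereal A" "ereal (real n)"] by simp
    then have "x \<in> G n" by (simp add: G_def)
    then show "x \<in> \<Union> (range G)" by blast
  qed
  then have "interior (\<Union> (range G)) \<noteq> {}"
    using assms(2) interior_mono by blast
  then have "\<exists>n. interior (G n) \<noteq> {}"
    using Baire_category_alt[of "euclidean :: 'e topology" "range G"] assms(1)
    by (auto simp: G_def norm_lsc_def completely_metrizable_space_euclidean)
  then obtain n z where "z \<in> interior (G n)" by blast
  then obtain \<rho> where "\<rho> > 0" "ball z \<rho> \<subseteq> G n" by (meson mem_interior)
  then show thesis using that[of \<rho> z "real n"] by (auto simp: G_def ball_def dist_commute)
qed

text \<open>Prolong the segment from \<open>z\<close> slightly beyond \<open>a\<close> within the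
  domain. Points near \<open>a\<close> are convex combinations of the far end and of points of the
  ball around \<open>z\<close>, on which \<open>F\<close> is bounded.\<close>

lemma convex_lsc_bounded_above_near:
  fixes F :: "'e::banach \<Rightarrow> ereal"
  assumes "convex_efun F" "norm_lsc F" "a \<in> interior (edom F)"
  obtains r M where "r > 0" "\<And>y. dist y a < r \<Longrightarrow> F y \<le> ereal M"
proof -
  obtain z \<rho> n where \<rho>: "\<rho> > 0" "\<And>y. dist y z < \<rho> \<Longrightarrow> F y \<le> ereal n"
    by (rule norm_lsc_bounded_above_somewhere[OF assms(2)]) (use assms(3) in auto)
  obtain e where e: "e > 0" "ball a e \<subseteq> edom F" using assms(3) by (meson mem_interior)
  \<comment> \<open>The summand 1 covers the case \<open>a = z\<close>.\<close>
  define s where "s = e / (2 * (norm (a - z) + 1))"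
  have 1: "norm (a - z) + 1 > 0" by (rule add_nonneg_pos) auto
  then have "s > 0" using e(1) unfolding s_def by (intro divide_pos_pos mult_pos_pos) auto
  have "s * norm (a - z) \<le> s * (norm (a - z) + 1)" using \<open>s > 0\<close> by simp
  also have "\<dots> = e / 2" using 1 unfolding s_def by (simp add: divide_simps)
  finally have "s * norm (a - z) < e" using e by simp
  then have "a + s *\<^sub>R (a - z) \<in> edom F"
    using e \<open>s > 0\<close> by (intro subsetD[OF e(2)]) (simp add: dist_norm)
  then obtain B where B: "F (a + s *\<^sub>R (a - z)) \<le> ereal B" unfolding edom_le_real ..
  \<comment> \<open>The weight for which \<open>a\<close> is the combination of
    \<open>a + s *\<^sub>R (a - z)\<close> and \<open>z\<close>, that is,
    \<open>(1 - t) * s = t\<close>.\<close>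
  define t where "t = s / (1 + s)"
  have t: "0 < t" "t < 1" "(1 - t) * s = t" using \<open>s > 0\<close> by (auto simp: t_def field_simps)
  show thesis
  proof
    show "t * \<rho> > 0" using t \<rho> by simp
    fix y assume y: "dist y a < t * \<rho>"
    define v where "v = (1 / t) *\<^sub>R (y - a)"
    have tv: "t *\<^sub>R v = y - a" using t by (simp add: v_def)
    have "t * norm v < t * \<rho>" using y t tv by (metis abs_of_pos dist_norm norm_scaleR)
    then have "norm v < \<rho>" using t by simp
    then have "F ((1 - t) *\<^sub>R (a + s *\<^sub>R (a - z)) + t *\<^sub>R (z + v)) \<le> ereal ((1 - t) * B + t * n)"
      using t by (intro convex_efun_le assms B \<rho>) (auto simp: dist_norm)
    also have "(1 - t) *\<^sub>R (a + s *\<^sub>R (a - z)) + t *\<^sub>R (z + v)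
        = (1 - t) *\<^sub>R a + ((1 - t) * s) *\<^sub>R (a - z) + t *\<^sub>R z + t *\<^sub>R v"
      by (simp add: scaleR_add_right)
    also have "\<dots> = y" unfolding t(3) tv by (simp add: algebra_simps)
    finally show "F y \<le> ereal ((1 - t) * B + t * n)" .
  qed
qed

text \<open>The subgradient inequality bounds \<open>\<xi>\<close> by \<open>M - m\<close> on the
  open ball of radius \<open>r\<close>. The factor 2 comes from testing with vectors of norm
  \<open>r / 2\<close>, which lie inside it.\<close>

lemma norm_subgradient_le:
  assumes "subgradient F s \<xi>" "r > 0" "\<And>y. dist y s < r \<Longrightarrow> F y \<le> ereal M" "ereal m \<le> F s"
  shows "norm \<xi> \<le> 2 * (M - m) / r"
proof -
  obtain f where f: "F s = ereal f" using assms(1) by (cases "F s") (auto simp: subgradient_def)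
  have *: "blinfun_apply \<xi> u \<le> M - m" if "norm u < r" for u
  proof -
    have "F s + ereal (blinfun_apply \<xi> (s + u - s)) \<le> F (s + u)"
      using assms(1) unfolding subgradient_def by blast
    also have "\<dots> \<le> ereal M" using that by (intro assms(3)) (simp add: dist_norm)
    finally show ?thesis using assms(4) by (simp add: f)
  qed
  have 0: "M - m \<ge> 0" using *[of 0] assms(2) by simp
  show ?thesis
  proof (rule norm_blinfun_bound)
    show "0 \<le> 2 * (M - m) / r" using 0 assms(2) by simp
    fix x
    have **: "blinfun_apply \<xi> x \<le> 2 * (M - m) / r * norm x" for x
    proof (cases "x = 0")
      case False
      have "blinfun_apply \<xi> ((r / (2 * norm x)) *\<^sub>R x) \<le> M - m"
        using False assms(2) by (intro *) simp
      then show ?thesis using False assms(2) by (simp add: blinfun.scaleR_right field_simps)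
    qed (simp add: blinfun.zero_right)
    show "norm (blinfun_apply \<xi> x) \<le> 2 * (M - m) / r * norm x"
      using **[of x] **[of "- x"] by (simp add: blinfun.minus_right abs_le_iff)
  qed
qed

lemma subgradientD:
  assumes "subgradient F s \<xi>" "F s = ereal f" "F y = ereal f'"
  shows "f + blinfun_apply \<xi> (y - s) \<le> f'"
  using assms unfolding subgradient_def by (metis ereal_less_eq(3) plus_ereal.simps(1))

lemma blinfun_apply_le_norm:
  fixes \<xi> :: "'e::real_normed_vector \<Rightarrow>\<^sub>L real"
  assumes "norm \<xi> \<le> K" "norm u \<le> d"
  shows "\<bar>blinfun_apply \<xi> u\<bar> \<le> K * d"
proof -
  have "\<bar>blinfun_apply \<xi> u\<bar> \<le> norm \<xi> * norm u" using norm_blinfun[of \<xi> u] by simp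
  also have "\<dots> \<le> K * d" using assms by (intro mult_mono) (auto intro: order_trans[OF norm_ge_zero])
  finally show ?thesis .
qed

text \<open>The upper bound spreads from the endpoints along the segment; the lower bound is the
  affine minorant given by \<open>\<xi>0\<close>.\<close>

lemma subgradients_bounded_near_segment:
  fixes F :: "'e::banach \<Rightarrow> ereal"
  assumes "convex_efun F" "norm_lsc F" and ab: "a \<in> interior (edom F)" "b \<in> interior (edom F)"
    and "subgradient F s0 \<xi>0"
  obtains r K where "r > 0" "K > 0"
    "\<And>t y. 0 \<le> t \<Longrightarrow> t \<le> 1 \<Longrightarrow> dist y ((1 - t) *\<^sub>R a + t *\<^sub>R b) < r \<Longrightarrow> y \<in> interior (edom F)"
    "\<And>t s \<xi>. 0 \<le> t \<Longrightarrow> t \<le> 1 \<Longrightarrow> dist s ((1 - t) *\<^sub>R a + t *\<^sub>R b) < r \<Longrightarrow>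
        subgradient F s \<xi> \<Longrightarrow> norm \<xi> \<le> K"
proof -
  obtain r1 M1 where 1: "r1 > 0" "\<And>y. dist y a < r1 \<Longrightarrow> F y \<le> ereal M1"
    by (rule convex_lsc_bounded_above_near[OF assms(1,2) ab(1)]) blast
  obtain r2 M2 where 2: "r2 > 0" "\<And>y. dist y b < r2 \<Longrightarrow> F y \<le> ereal M2"
    by (rule convex_lsc_bounded_above_near[OF assms(1,2) ab(2)]) blast
  \<comment> \<open>Halved so that a ball of radius \<open>r\<close> about any point of the
    \<open>r\<close>-tube stays in the tube where \<open>F\<close> is bounded above.\<close>
  define r where "r = min r1 r2 / 2"
  have r: "r > 0" using 1 2 by (simp add: r_def)
  have tube: "F y \<le> ereal (max M1 M2)"
    if "0 \<le> t" "t \<le> 1" "dist y ((1 - t) *\<^sub>R a + t *\<^sub>R b) < 2 * r" for t y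
  proof (rule convex_efun_bounded_tube[OF assms(1) _ _ that])
    show "F y \<le> ereal (max M1 M2)" if "dist y a < 2 * r" for y
      using 1(2)[of y] that by (auto simp: r_def max_def intro: order_trans)
    show "F y \<le> ereal (max M1 M2)" if "dist y b < 2 * r" for y
      using 2(2)[of y] that by (auto simp: r_def max_def intro: order_trans)
  qed
  obtain f0 where f0: "F s0 = ereal f0" using assms(5) by (cases "F s0") (auto simp: subgradient_def)
  \<comment> \<open>A lower bound on the \<open>r\<close>-tube for the affine minorant at
    \<open>s0\<close>.\<close>
  define m where "m = f0 - norm \<xi>0 * (norm a + norm b + r + norm s0)"
  have low: "ereal m \<le> F y"
    if "0 \<le> t" "t \<le> 1" "dist y ((1 - t) *\<^sub>R a + t *\<^sub>R b) < r" for t y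
  proof -
    have "norm y \<le> norm ((1 - t) *\<^sub>R a + t *\<^sub>R b) + r"
      using that(3) norm_triangle_sub[of y "(1 - t) *\<^sub>R a + t *\<^sub>R b"] by (simp add: dist_norm)
    moreover have "norm ((1 - t) *\<^sub>R a + t *\<^sub>R b) \<le> norm a + norm b"
      using that(1,2) norm_triangle_ineq[of "(1 - t) *\<^sub>R a" "t *\<^sub>R b"]
        mult_right_mono[of "1 - t" 1 "norm a"] mult_right_mono[of t 1 "norm b"] by simp
    ultimately have "norm (y - s0) \<le> norm a + norm b + r + norm s0"
      using norm_triangle_ineq4[of y s0] by linarith
    then have "\<bar>blinfun_apply \<xi>0 (y - s0)\<bar> \<le> norm \<xi>0 * (norm a + norm b + r + norm s0)"
      by (rule blinfun_apply_le_norm[OF order_refl])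
    then have "ereal m \<le> F s0 + ereal (blinfun_apply \<xi>0 (y - s0))" by (simp add: f0 m_def)
    also have "\<dots> \<le> F y" using assms(5) unfolding subgradient_def by blast
    finally show ?thesis .
  qed
  \<comment> \<open>The maximum with 1 makes \<open>K\<close> positive, so that it may be divided
    by.\<close>
  define K where "K = max 1 (2 * (max M1 M2 - m) / r)"
  show thesis
  proof (rule that[OF r, of K])
    show "K > 0" by (simp add: K_def)
    fix t :: real and y assume y: "0 \<le> t" "t \<le> 1" "dist y ((1 - t) *\<^sub>R a + t *\<^sub>R b) < r"
    have near: "F z \<le> ereal (max M1 M2)" if "dist z y < r" for z
      by (rule tube[OF y(1,2)]) (use dist_triangle[of z "(1 - t) *\<^sub>R a + t *\<^sub>R b" y] y(3) that in linarith)
    have "ball y r \<subseteq> edom F"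
    proof
      fix x assume "x \<in> ball y r"
      then have "F x \<le> ereal (max M1 M2)" by (intro near) (simp add: dist_commute)
      then show "x \<in> edom F" unfolding edom_le_real ..
    qed
    then show "y \<in> interior (edom F)" using r by (meson mem_interior)
    fix \<xi> assume "subgradient F y \<xi>"
    then show "norm \<xi> \<le> K"
      using norm_subgradient_le[of F y \<xi>, OF _ r near low[OF y]] by (simp add: K_def)
  qed
qed

lemma subgradient_finiteE:
  assumes "subgradient F s \<xi>"
  obtains f where "F s = ereal f"
  using assms by (cases "F s") (auto simp: subgradient_def)

text \<open>Over one step \<open>H\<close> grows by at least \<open>\<xi> j\<close> of the step and
  \<open>F\<close> by at most \<open>\<xi> (Suc j)\<close> of it; the discrepancies add up to
  \<open>O(1/N)\<close>. Using \<open>\<rho>\<close> below \<open>H a\<close> admits an infinite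
  \<open>H a\<close>, and exchanging the endpoints gives the reverse estimate.\<close>

lemma common_subgradient_increment_le:
  fixes F H :: "'e::banach \<Rightarrow> ereal"
  assumes F: "convex_efun F" "norm_lsc F" and H: "norm_lsc H"
    and R: "\<And>s \<xi>. (s, \<xi>) \<in> R \<Longrightarrow> subgradient F s \<xi> \<and> subgradient H s \<xi>"
    and dense: "interior (edom F) \<subseteq> closure (fst ` R)"
    and a: "a \<in> interior (edom F)" "F a = ereal fa" "ereal \<rho> < H a"
    and b: "b \<in> interior (edom F)" "F b = ereal fb"
  shows "ereal (\<rho> + fb - fa) \<le> H b"
proof (rule ereal_le_epsilon2)
  fix \<epsilon> :: real assume \<epsilon>: "0 < \<epsilon>"
  have "fst ` R \<noteq> {}" using dense a(1) by fastforce
  then obtain s0 \<xi>0 where "subgradient F s0 \<xi>0" using R by fastforce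
  then obtain r K where r: "r > 0" "K > 0"
    and tube: "\<And>t y. 0 \<le> t \<Longrightarrow> t \<le> 1 \<Longrightarrow> dist y ((1 - t) *\<^sub>R a + t *\<^sub>R b) < r \<Longrightarrow> y \<in> interior (edom F)"
    and bdd: "\<And>t s \<xi>. 0 \<le> t \<Longrightarrow> t \<le> 1 \<Longrightarrow> dist s ((1 - t) *\<^sub>R a + t *\<^sub>R b) < r \<Longrightarrow>
        subgradient F s \<xi> \<Longrightarrow> norm \<xi> \<le> K"
    by (rule subgradients_bounded_near_segment[OF F a(1) b(1)]) blast
  obtain d1 where d1: "d1 > 0" "\<And>x. dist x a < d1 \<Longrightarrow> ereal \<rho> < H x"
    by (rule norm_lscD[OF H a(3)]) blast
  have "ereal (fb - \<epsilon> / 4) < F b" using b(2) \<epsilon> by simp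
  then obtain d2 where d2: "d2 > 0" "\<And>x. dist x b < d2 \<Longrightarrow> ereal (fb - \<epsilon> / 4) < F x"
    by (rule norm_lscD[OF F(2)]) blast
  \<comment> \<open>Chosen so that the telescoped error \<open>2 * K * norm (b - a) / N\<close> is
    at most a quarter of \<open>\<epsilon>\<close>.\<close>
  obtain N0 :: nat where N0: "8 * K * norm (b - a) / \<epsilon> \<le> real N0" using real_arch_simple by blast
  define N where "N = Suc N0"
  have N: "N > 0" "2 * K * (norm (b - a) / N) \<le> \<epsilon> / 4"
  proof -
    have "8 * K * norm (b - a) / \<epsilon> \<le> real N" using N0 by (simp add: N_def)
    then show "2 * K * (norm (b - a) / N) \<le> \<epsilon> / 4"
      using \<epsilon> by (simp add: N_def field_simps)
  qed (simp add: N_def)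
  \<comment> \<open>Misplaced base points cost \<open>4 * K * \<delta>\<close> in each of
    \<open>N\<close> steps and \<open>K * \<delta>\<close> at each end;
    \<open>\<delta> \<le> c\<close> keeps the total within another quarter.\<close>
  define c where "c = \<epsilon> / (4 * (4 * real N + 2) * K)"
  have c: "c > 0" "(4 * real N + 2) * K * c = \<epsilon> / 4"
    using \<epsilon> r N by (auto simp: c_def divide_simps)
  \<comment> \<open>The bounds \<open>r\<close>, \<open>d1\<close> and \<open>d2\<close> keep the
    base points in the tube, the first one where \<open>H\<close> exceeds \<open>\<rho>\<close>, and
    the last one where \<open>F\<close> exceeds \<open>fb - \<epsilon> / 4\<close>.\<close>
  define \<delta> where "\<delta> = min (min r c) (min d1 d2)"
  have \<delta>: "\<delta> > 0" "\<delta> \<le> r" "\<delta> \<le> c" "\<delta> \<le> d1" "\<delta> \<le> d2"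
    using r c d1 d2 by (auto simp: \<delta>_def)
  define p where "p = (\<lambda>i. (1 - real i / N) *\<^sub>R a + (real i / N) *\<^sub>R b)"
  have "\<exists>q. q \<in> R \<and> dist (fst q) (p i) < \<delta>" if "i \<le> N" for i
  proof -
    have "p i \<in> interior (edom F)"
      using that N r by (intro tube[of "real i / N"]) (auto simp: p_def)
    then show ?thesis using dense \<delta>(1) by (fastforce simp: closure_approachable)
  qed
  then obtain q where q: "\<And>i. i \<le> N \<Longrightarrow> q i \<in> R" "\<And>i. i \<le> N \<Longrightarrow> dist (fst (q i)) (p i) < \<delta>"
    by metis
  define s \<xi> where "s = (\<lambda>i. fst (q i))" and "\<xi> = (\<lambda>i. snd (q i))"
  have sub: "subgradient F (s i) (\<xi> i)" "subgradient H (s i) (\<xi> i)" if "i \<le> N" for i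
    using R[of "s i" "\<xi> i"] q(1)[OF that] by (auto simp: s_def \<xi>_def)
  have near: "norm (s i - p i) \<le> \<delta>" "dist (s i) (p i) < \<delta>" if "i \<le> N" for i
    using q(2)[OF that] by (auto simp: s_def dist_norm)
  have \<xi>K: "norm (\<xi> i) \<le> K" if "i \<le> N" for i
    using near(2)[OF that] sub(1)[OF that] \<delta>(2) that N
    by (intro bdd[of "real i / N" "s i"]) (auto simp: p_def)
  define f h where "f = (\<lambda>i. real_of_ereal (F (s i)))" and "h = (\<lambda>i. real_of_ereal (H (s i)))"
  have f: "F (s i) = ereal (f i)" and h: "H (s i) = ereal (h i)" if "i \<le> N" for i
    using sub[OF that] by (auto simp: f_def h_def subgradient_def ereal_real')
  have p_step: "p (Suc i) - p i = (1 / real N) *\<^sub>R (b - a)" for i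
    using N by (simp add: p_def algebra_simps add_divide_distrib)
  \<comment> \<open>As all steps of the subdivision are equal, the error terms \<open>(\<xi> (Suc j) - \<xi> j)(step)\<close> telescope.\<close>
  have D: "(f j - h j) - (f 0 - h 0)
      \<le> blinfun_apply (\<xi> j - \<xi> 0) ((1 / real N) *\<^sub>R (b - a)) + 4 * K * \<delta> * j" if "j \<le> N" for j
    using that
  proof (induction j)
    case (Suc j)
    have j: "j \<le> N" using Suc by simp
    \<comment> \<open>The deviation of the actual step from the ideal step
      \<open>(b - a) / N\<close>.\<close>
    define w where "w = (s (Suc j) - p (Suc j)) - (s j - p j)"
    have w: "norm w \<le> 2 * \<delta>"
      unfolding w_def using norm_triangle_ineq4[of "s (Suc j) - p (Suc j)" "s j - p j"]
        near(1)[OF j] near(1)[OF Suc.prems] by linarith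
    have sw: "s (Suc j) - s j = (1 / real N) *\<^sub>R (b - a) + w"
      using p_step[of j] by (simp add: w_def algebra_simps)
    have "h j + blinfun_apply (\<xi> j) (s (Suc j) - s j) \<le> h (Suc j)"
      by (rule subgradientD[OF sub(2)[OF j] h[OF j] h[OF Suc.prems]])
    moreover have "f (Suc j) + blinfun_apply (\<xi> (Suc j)) (s j - s (Suc j)) \<le> f j"
      by (rule subgradientD[OF sub(1)[OF Suc.prems] f[OF Suc.prems] f[OF j]])
    moreover have "blinfun_apply (\<xi> (Suc j)) (s j - s (Suc j)) = - blinfun_apply (\<xi> (Suc j)) (s (Suc j) - s j)"
      by (metis blinfun.minus_right minus_diff_eq)
    ultimately have "(f (Suc j) - h (Suc j)) - (f j - h j)
        \<le> blinfun_apply (\<xi> (Suc j)) (s (Suc j) - s j) - blinfun_apply (\<xi> j) (s (Suc j) - s j)"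
      by linarith
    also have "\<dots> = blinfun_apply (\<xi> (Suc j) - \<xi> j) ((1 / real N) *\<^sub>R (b - a))
        + blinfun_apply (\<xi> (Suc j)) w - blinfun_apply (\<xi> j) w"
      unfolding sw by (simp only: blinfun.add_right blinfun.diff_left)
    finally have "(f (Suc j) - h (Suc j)) - (f j - h j)
        \<le> blinfun_apply (\<xi> (Suc j) - \<xi> j) ((1 / real N) *\<^sub>R (b - a)) + 4 * K * \<delta>"
      using blinfun_apply_le_norm[OF \<xi>K[OF j] w] blinfun_apply_le_norm[OF \<xi>K[OF Suc.prems] w] by linarith
    then show ?case using Suc.IH[OF j] by (simp add: blinfun.diff_left algebra_simps)
  qed (simp add: blinfun.zero_left)
  have p0: "p 0 = a" and pN: "p N = b" using N by (auto simp: p_def)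
  have "norm (\<xi> N - \<xi> 0) \<le> 2 * K"
    using norm_triangle_ineq4[of "\<xi> N" "\<xi> 0"] \<xi>K[of 0] \<xi>K[of N] by simp
  then have "\<bar>blinfun_apply (\<xi> N - \<xi> 0) ((1 / real N) *\<^sub>R (b - a))\<bar> \<le> 2 * K * (norm (b - a) / N)"
    by (rule blinfun_apply_le_norm) simp
  then have D': "(f N - h N) - (f 0 - h 0) \<le> \<epsilon> / 4 + 4 * K * \<delta> * N"
    using D[of N] N(2) by simp
  have small: "4 * K * \<delta> * N + 2 * (K * \<delta>) \<le> \<epsilon> / 4"
  proof -
    have "(4 * real N + 2) * K * \<delta> \<le> (4 * real N + 2) * K * c"
      using \<delta>(3) r by (intro mult_left_mono) auto
    then show ?thesis using c(2) by (simp add: algebra_simps)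
  qed
  \<comment> \<open>Passage from \<open>s 0\<close>, \<open>s N\<close> back to \<open>a\<close>,
    \<open>b\<close>: semicontinuity of \<open>H\<close> at \<open>a\<close> and of \<open>F\<close>
    at \<open>b\<close>, and the bounded subgradients \<open>\<xi> 0\<close> for \<open>F\<close>
    and \<open>\<xi> N\<close> for \<open>H\<close>.\<close>
  have "\<rho> < h 0" using d1(2)[of "s 0"] near(2)[of 0] \<delta>(4) by (simp add: p0 h)
  moreover have "f 0 + blinfun_apply (\<xi> 0) (a - s 0) \<le> fa"
    by (rule subgradientD[OF sub(1) f a(2)]) auto
  moreover have "\<bar>blinfun_apply (\<xi> 0) (a - s 0)\<bar> \<le> K * \<delta>"
    using near(1)[of 0] by (intro blinfun_apply_le_norm \<xi>K) (auto simp: p0 norm_minus_commute)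
  moreover have "fb - \<epsilon> / 4 < f N" using d2(2)[of "s N"] near(2)[of N] \<delta>(5) by (simp add: pN f)
  moreover have "\<bar>blinfun_apply (\<xi> N) (b - s N)\<bar> \<le> K * \<delta>"
    using near(1)[of N] by (intro blinfun_apply_le_norm \<xi>K) (auto simp: pN norm_minus_commute)
  ultimately have "\<rho> + fb - fa - \<epsilon> \<le> h N + blinfun_apply (\<xi> N) (b - s N)"
    using D' small \<epsilon> by linarith
  then have "ereal (\<rho> + fb - fa - \<epsilon>) \<le> H (s N) + ereal (blinfun_apply (\<xi> N) (b - s N))"
    by (simp add: h)
  also have "\<dots> \<le> H b" using sub(2)[of N] by (simp add: subgradient_def)
  finally have "ereal (\<rho> + fb - fa - \<epsilon>) + ereal \<epsilon> \<le> H b + ereal \<epsilon>" by (rule add_right_mono)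
  then show "ereal (\<rho> + fb - fa) \<le> H b + ereal \<epsilon>" by simp
qed

section \<open>From the interior to the whole domain\<close>

text \<open>Near \<open>a\<close> the chord bounds \<open>Q\<close>, hence \<open>P\<close>, from
  above; lower semicontinuity of \<open>P\<close> carries the bound to \<open>a\<close>.\<close>

lemma le_limit_along_segment:
  fixes P Q :: "'e::real_normed_vector \<Rightarrow> ereal"
  assumes "norm_lsc P" "convex_efun Q" "Q a \<le> ereal qa" "Q z < \<infinity>"
    and eq: "\<And>t. 0 < t \<Longrightarrow> t \<le> 1 \<Longrightarrow> P ((1 - t) *\<^sub>R a + t *\<^sub>R z) = Q ((1 - t) *\<^sub>R a + t *\<^sub>R z) + ereal c"
  shows "P a \<le> ereal (qa + c)"
proof (rule ccontr)
  assume "\<not> P a \<le> ereal (qa + c)"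
  then obtain \<rho> where \<rho>: "ereal (qa + c) < ereal \<rho>" "ereal \<rho> < P a"
    by (metis ereal_dense2 not_le)
  obtain d where d: "d > 0" "\<And>x. dist x a < d \<Longrightarrow> ereal \<rho> < P x"
    by (rule norm_lscD[OF assms(1) \<rho>(2)]) blast
  obtain qz where qz: "Q z \<le> ereal qz" using assms(4) edom_le_real[of z Q] by (auto simp: edom_def)
  \<comment> \<open>Small enough both to enter the neighbourhood of \<open>a\<close> where
    \<open>P\<close> exceeds \<open>\<rho>\<close> and to keep the rise of the chord below
    \<open>\<rho> - qa - c\<close>.\<close>
  define t where "t = min 1 (min (d / (2 * (norm (z - a) + 1))) ((\<rho> - qa - c) / (\<bar>qz - qa\<bar> + 1)))"
  have pos: "norm (z - a) + 1 > 0" "\<bar>qz - qa\<bar> + 1 > 0" by (auto intro: add_nonneg_pos)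
  have t: "0 < t" "t \<le> 1" using d(1) \<rho>(1) pos by (auto simp: t_def)
  have "t * (norm (z - a) + 1) \<le> d / (2 * (norm (z - a) + 1)) * (norm (z - a) + 1)"
    using pos by (intro mult_right_mono) (auto simp: t_def)
  also have "\<dots> = d / 2" using pos by (simp add: divide_simps)
  finally have "t * norm (z - a) < d" using d(1) t(1) by (simp add: distrib_left)
  moreover have "(1 - t) *\<^sub>R a + t *\<^sub>R z - a = t *\<^sub>R (z - a)" by (simp add: algebra_simps)
  ultimately have "ereal \<rho> < P ((1 - t) *\<^sub>R a + t *\<^sub>R z)"
    using t by (intro d(2)) (simp add: dist_norm)
  also have "\<dots> \<le> ereal ((1 - t) * qa + t * qz) + ereal c"
    unfolding eq[OF t] using t by (intro add_right_mono convex_efun_le assms(2,3) qz) auto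
  finally have "\<rho> - qa - c < t * (qz - qa)" by (simp add: algebra_simps)
  also have "\<dots> \<le> t * \<bar>qz - qa\<bar>" using t by (intro mult_left_mono) auto
  also have "\<dots> < t * (\<bar>qz - qa\<bar> + 1)" using t by simp
  also have "\<dots> \<le> (\<rho> - qa - c) / (\<bar>qz - qa\<bar> + 1) * (\<bar>qz - qa\<bar> + 1)"
    using pos by (intro mult_right_mono) (auto simp: t_def)
  also have "\<dots> = \<rho> - qa - c" using pos by simp
  finally show False by simp
qed

text \<open>The homothety with centre \<open>a\<close> and ratio \<open>t\<close> maps a ball about
  \<open>z\<close> in the domain to a ball about the given point.\<close>

lemma interior_edom_segment:
  fixes F :: "'e::real_normed_vector \<Rightarrow> ereal"
  assumes "convex_efun F" "a \<in> edom F" "z \<in> interior (edom F)" "0 < t" "t \<le> 1"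
  shows "(1 - t) *\<^sub>R a + t *\<^sub>R z \<in> interior (edom F)"
proof -
  obtain r where r: "r > 0" "ball z r \<subseteq> edom F" using assms(3) by (meson mem_interior)
  obtain A where A: "F a \<le> ereal A" using assms(2) unfolding edom_le_real ..
  have "ball ((1 - t) *\<^sub>R a + t *\<^sub>R z) (t * r) \<subseteq> edom F"
  proof
    fix y assume y: "y \<in> ball ((1 - t) *\<^sub>R a + t *\<^sub>R z) (t * r)"
    define v where "v = (1 / t) *\<^sub>R (y - ((1 - t) *\<^sub>R a + t *\<^sub>R z))"
    have tv: "t *\<^sub>R v = y - ((1 - t) *\<^sub>R a + t *\<^sub>R z)" using assms(4) by (simp add: v_def)
    then have "t * norm v < t * r" using y assms(4)
      by (metis abs_of_pos dist_commute dist_norm mem_ball norm_scaleR)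
    then have "z + v \<in> edom F" using assms(4) by (intro subsetD[OF r(2)]) (simp add: dist_norm)
    then obtain B where B: "F (z + v) \<le> ereal B" unfolding edom_le_real ..
    have "F ((1 - t) *\<^sub>R a + t *\<^sub>R (z + v)) \<le> ereal ((1 - t) * A + t * B)"
      using assms by (intro convex_efun_le A B) auto
    moreover have "(1 - t) *\<^sub>R a + t *\<^sub>R (z + v) = y" using tv by (simp add: algebra_simps)
    ultimately show "y \<in> edom F" unfolding edom_le_real by auto
  qed
  then show ?thesis using r(1) assms(4) by (meson mem_interior mult_pos_pos)
qed

theorem common_subgradients_differ_by_constant:
  fixes F H :: "'e::banach \<Rightarrow> ereal"
  assumes F: "convex_efun F" "norm_lsc F" "\<And>x. F x \<noteq> -\<infinity>"
    and H: "convex_efun H" "norm_lsc H" "\<And>x. H x \<noteq> -\<infinity>"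
    and R: "\<And>s \<xi>. (s, \<xi>) \<in> R \<Longrightarrow> subgradient F s \<xi> \<and> subgradient H s \<xi>"
    and dense: "interior (edom F) \<subseteq> closure (fst ` R)"
    and ne: "interior (edom F) \<noteq> {}"
  obtains c :: real where "\<And>a. a \<in> edom F \<Longrightarrow> H a = F a + ereal c"
proof -
  obtain z where z: "z \<in> interior (edom F)" using ne by blast
  \<comment> \<open>Density puts a base point \<open>s\<close> in the interior; both functions are
    finite there, and \<open>s\<close> fixes the constant.\<close>
  have "fst ` R \<inter> interior (edom F) \<noteq> {}"
    using z dense open_Int_closure_eq_empty[OF open_interior, of "edom F" "fst ` R"] by blast
  then obtain s \<xi> where s: "(s, \<xi>) \<in> R" "s \<in> interior (edom F)" by auto
  obtain fs where fs: "F s = ereal fs" using R[OF s(1)] subgradient_finiteE by blast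
  obtain hs where hs: "H s = ereal hs" using R[OF s(1)] subgradient_finiteE by blast
  define c where "c = hs - fs"
  have fin: "\<exists>f. F x = ereal f" if "x \<in> edom F" for x
    using that F(3)[of x] by (cases "F x") (auto simp: edom_def)
  have incr: "ereal (\<rho> + fb - fa) \<le> H b"
    if "a \<in> interior (edom F)" "F a = ereal fa" "ereal \<rho> < H a"
      "b \<in> interior (edom F)" "F b = ereal fb" for a b \<rho> fa fb
    by (rule common_subgradient_increment_le[OF F(1,2) H(2) R dense that])
  have int: "H x = F x + ereal c" if x: "x \<in> interior (edom F)" for x
  proof -
    obtain f where f: "F x = ereal f" using fin x interior_subset by blast
    have "H x \<le> ereal (f + c)"
    proof (rule ccontr)
      assume "\<not> H x \<le> ereal (f + c)"
      then obtain \<rho> where \<rho>: "ereal (f + c) < ereal \<rho>" "ereal \<rho> < H x"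
        by (metis ereal_dense2 not_le)
      show False using incr[OF x f \<rho>(2) s(2) fs] \<rho>(1) by (simp add: hs c_def)
    qed
    moreover have "ereal (f + c) \<le> H x + ereal e" if "e > 0" for e
    proof -
      have "ereal (hs - e) < H s" using that by (simp add: hs)
      from incr[OF s(2) fs this x f] have "ereal (hs - e + f - fs) \<le> H x" by simp
      then have "ereal (hs - e + f - fs) + ereal e \<le> H x + ereal e" by (rule add_right_mono)
      then show ?thesis by (simp add: c_def algebra_simps)
    qed
    ultimately show ?thesis using ereal_le_epsilon2[of "ereal (f + c)" "H x"] by (simp add: f)
  qed
  show thesis
  proof
    fix a assume a: "a \<in> edom F"
    obtain f where f: "F a = ereal f" using fin a by blast
    obtain fz where fz: "F z = ereal fz" using fin z interior_subset by blast
    note seg = int[OF interior_edom_segment[OF F(1) a z]]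
    have 1: "H a \<le> ereal (f + c)"
      by (rule le_limit_along_segment[OF H(2) F(1) _ _ seg, of f]) (auto simp: f fz)
    \<comment> \<open>Only now is \<open>H\<close> known to be finite at \<open>a\<close>, which
      allows the same limit argument with \<open>F\<close> and \<open>H\<close> exchanged.\<close>
    then obtain h where h: "H a = ereal h" using H(3)[of a] by (cases "H a") auto
    have "F a \<le> ereal (h + (- c))"
    proof (rule le_limit_along_segment[OF F(2) H(1), of a h z])
      fix t :: real assume t: "0 < t" "t \<le> 1"
      let ?x = "(1 - t) *\<^sub>R a + t *\<^sub>R z"
      obtain g where g: "F ?x = ereal g"
        using fin interior_edom_segment[OF F(1) a z t] interior_subset by blast
      then show "F ?x = H ?x + ereal (- c)" using seg[OF t] by simp
    qed (auto simp: h int[OF z] fz)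
    then show "H a = F a + ereal c" using 1 by (simp add: f h)
  qed
qed

subsection \<open>Affine minorants of weak-star lower semicontinuous functions\<close>

text \<open>The first-order condition at an endpoint: divide by \<open>t\<close> and make
  \<open>t\<close> small.\<close>

lemma nonneg_of_quadratic_nonneg:
  fixes a b :: real
  assumes "\<And>t. 0 < t \<Longrightarrow> t \<le> 1 \<Longrightarrow> 0 \<le> t * a + t\<^sup>2 * b"
  shows "0 \<le> a"
proof (rule ccontr)
  assume "\<not> 0 \<le> a"
  define t where "t = min 1 (- a / (2 * (\<bar>b\<bar> + 1)))"
  have t: "0 < t" "t \<le> 1" using \<open>\<not> 0 \<le> a\<close> by (auto simp: t_def field_simps)
  have "t * (\<bar>b\<bar> + 1) \<le> - a / (2 * (\<bar>b\<bar> + 1)) * (\<bar>b\<bar> + 1)"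
    by (intro mult_right_mono) (auto simp: t_def)
  also have "\<dots> = - a / 2" by (simp add: divide_simps)
  finally have "t * (\<bar>b\<bar> + 1) \<le> - a / 2" .
  moreover have "t * b \<le> t * (\<bar>b\<bar> + 1)" using t by (intro mult_left_mono) auto
  ultimately have "a + t * b < 0" using \<open>\<not> 0 \<le> a\<close> by linarith
  then have "t * (a + t * b) < 0" using t(1) by (simp add: mult_pos_neg)
  then show False using assms[OF t] by (simp add: power2_eq_square algebra_simps)
qed

text \<open>A Lagrange multiplier without separation: \<open>w\<close> is the gradient of the
  penalty at the limit \<open>L\<close> of the coordinates of a minimising sequence. The infimum may
  fail to be attained; convergence of the coordinates suffices, as the penalty depends on nothing
  else.\<close>

lemma convex_penalty_multiplier:
  fixes G :: "'v::real_vector \<Rightarrow> real" and l :: "'i \<Rightarrow> 'v \<Rightarrow> real" and \<alpha> :: "'i \<Rightarrow> real"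
  assumes "convex_on D G" "D \<noteq> {}" "finite I" "\<And>i. i \<in> I \<Longrightarrow> linear (l i)" "c > 0"
    and bound: "\<And>p. p \<in> D \<Longrightarrow> \<beta> \<le> G p + c * (\<Sum>i\<in>I. (l i p - \<alpha> i)\<^sup>2)"
  obtains w where "\<And>p. p \<in> D \<Longrightarrow> \<beta> \<le> G p + (\<Sum>i\<in>I. w i * (l i p - \<alpha> i))"
proof -
  define \<phi> where "\<phi> = (\<lambda>p. G p + c * (\<Sum>i\<in>I. (l i p - \<alpha> i)\<^sup>2))"
  define m where "m = Inf (\<phi> ` D)"
  have bb: "bdd_below (\<phi> ` D)" using bound by (intro bdd_belowI2[of D \<beta>]) (auto simp: \<phi>_def)
  have m: "m \<le> \<phi> p" if "p \<in> D" for p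
    unfolding m_def using bb that by (intro cInf_lower) auto
  have \<beta>m: "\<beta> \<le> m" unfolding m_def using assms(2) bound by (intro cInf_greatest) (auto simp: \<phi>_def)
  have "\<exists>p\<in>D. \<phi> p < m + 1 / real (Suc n)" for n
  proof -
    have "Inf (\<phi> ` D) < m + 1 / real (Suc n)" by (simp add: m_def)
    then show ?thesis using cInf_lessD[of "\<phi> ` D"] assms(2) by fastforce
  qed
  then obtain p where p: "\<And>n. p n \<in> D" "\<And>n. \<phi> (p n) < m + 1 / real (Suc n)" by metis
  have comb: "\<phi> ((1 - t) *\<^sub>R x + t *\<^sub>R y) \<le> (1 - t) * G x + t * G y
      + c * (\<Sum>i\<in>I. ((l i x - \<alpha> i) + t * (l i y - l i x))\<^sup>2)" and comb_in: "(1 - t) *\<^sub>R x + t *\<^sub>R y \<in> D"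
    if "x \<in> D" "y \<in> D" "0 \<le> t" "t \<le> 1" for x y t
  proof -
    have "(\<Sum>i\<in>I. (l i ((1 - t) *\<^sub>R x + t *\<^sub>R y) - \<alpha> i)\<^sup>2) = (\<Sum>i\<in>I. ((l i x - \<alpha> i) + t * (l i y - l i x))\<^sup>2)"
    proof (intro sum.cong refl)
      fix i assume "i \<in> I"
      then have "l i ((1 - t) *\<^sub>R x + t *\<^sub>R y) - \<alpha> i = (l i x - \<alpha> i) + t * (l i y - l i x)"
        using assms(4) by (simp add: linear_add linear_scale) (simp add: algebra_simps)
      then show "(l i ((1 - t) *\<^sub>R x + t *\<^sub>R y) - \<alpha> i)\<^sup>2 = ((l i x - \<alpha> i) + t * (l i y - l i x))\<^sup>2"
        by (simp only:)
    qed
    then show "\<phi> ((1 - t) *\<^sub>R x + t *\<^sub>R y) \<le> (1 - t) * G x + t * G y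
      + c * (\<Sum>i\<in>I. ((l i x - \<alpha> i) + t * (l i y - l i x))\<^sup>2)"
      unfolding \<phi>_def using convex_onD[OF assms(1), of t x y] that by simp
    show "(1 - t) *\<^sub>R x + t *\<^sub>R y \<in> D"
      using convex_on_imp_convex[OF assms(1)] that by (intro convexD) auto
  qed
  \<comment> \<open>Comparing with the midpoint: the parallelogram law makes the coordinates of minimising sequences Cauchy.\<close>
  have gap: "c * (\<Sum>i\<in>I. (l i x - l i y)\<^sup>2) \<le> 2 * (\<phi> x - m) + 2 * (\<phi> y - m)"
    if "x \<in> D" "y \<in> D" for x y
  proof -
    let ?z = "(1 - 1/2 :: real) *\<^sub>R x + (1/2 :: real) *\<^sub>R y"
    have eq: "((u - w) + 1/2 * (v - u))\<^sup>2 = (u - w)\<^sup>2 / 2 + (v - w)\<^sup>2 / 2 - (u - v)\<^sup>2 / 4" for u v w :: real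
      by (simp add: power2_eq_square field_simps)
    have "m \<le> \<phi> ?z" using comb_in[OF that, of "1/2"] by (intro m) auto
    also have "\<dots> \<le> (1 - 1/2) * G x + 1/2 * G y
      + c * (\<Sum>i\<in>I. ((l i x - \<alpha> i) + 1/2 * (l i y - l i x))\<^sup>2)" using that by (intro comb) auto
    also have "(\<Sum>i\<in>I. ((l i x - \<alpha> i) + 1/2 * (l i y - l i x))\<^sup>2)
       = (\<Sum>i\<in>I. (l i x - \<alpha> i)\<^sup>2) / 2 + (\<Sum>i\<in>I. (l i y - \<alpha> i)\<^sup>2) / 2 - (\<Sum>i\<in>I. (l i x - l i y)\<^sup>2) / 4"
      unfolding eq by (simp add: sum.distrib sum_subtractf sum_divide_distrib)
    finally show ?thesis by (simp add: \<phi>_def algebra_simps)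
  qed
  have "Cauchy (\<lambda>n. l i (p n))" if "i \<in> I" for i
  proof (rule metric_CauchyI)
    fix e :: real assume "e > 0"
    \<comment> \<open>By \<open>gap\<close>, coordinates of index at least \<open>N\<close> have
      squared distance below \<open>4 / (c * (N + 1))\<close>.\<close>
    then obtain N where N: "4 / (c * e\<^sup>2) < real N" using reals_Archimedean2 by blast
    have "0 < c * e\<^sup>2" using \<open>e > 0\<close> assms(5) by simp
    then have N': "4 < c * e\<^sup>2 * real (Suc N)" using N by (simp add: divide_less_eq) (simp add: algebra_simps)
    have "dist (l i (p a)) (l i (p b)) < e" if "a \<ge> N" "b \<ge> N" for a b
    proof -
      have "c * (l i (p a) - l i (p b))\<^sup>2 \<le> c * (\<Sum>i\<in>I. (l i (p a) - l i (p b))\<^sup>2)"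
        using \<open>i \<in> I\<close> assms(3,5)
          member_le_sum[of i I "\<lambda>i. (l i (p a) - l i (p b))\<^sup>2"] by (intro mult_left_mono) auto
      also have "\<dots> \<le> 2 * (\<phi> (p a) - m) + 2 * (\<phi> (p b) - m)" by (rule gap[OF p(1) p(1)])
      also have "\<dots> < 2 * (1 / real (Suc a)) + 2 * (1 / real (Suc b))"
        using p(2)[of a] p(2)[of b]
        by (intro add_strict_mono mult_strict_left_mono) (simp_all add: diff_less_eq add.commute)
      also have "\<dots> \<le> 2 * (1 / real (Suc N)) + 2 * (1 / real (Suc N))"
        using that by (intro add_mono mult_left_mono divide_left_mono) auto
      also have "\<dots> = 4 / real (Suc N)" by simp
      also have "\<dots> < c * e\<^sup>2" using N' by (subst pos_divide_less_eq) auto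
      finally have "(l i (p a) - l i (p b))\<^sup>2 < e\<^sup>2" using assms(5) by simp
      then show ?thesis using \<open>e > 0\<close> power2_less_imp_less[of "\<bar>l i (p a) - l i (p b)\<bar>" e]
        by (simp add: dist_real_def)
    qed
    then show "\<exists>M. \<forall>m\<ge>M. \<forall>n\<ge>M. dist (l i (p m)) (l i (p n)) < e" by blast
  qed
  then have "\<forall>i. \<exists>L. i \<in> I \<longrightarrow> (\<lambda>n. l i (p n)) \<longlonglongrightarrow> L"
    using Cauchy_convergent_iff convergent_def by blast
  then obtain L where L: "\<And>i. i \<in> I \<Longrightarrow> (\<lambda>n. l i (p n)) \<longlonglongrightarrow> L i" by metis
  define S where "S = (\<Sum>i\<in>I. (L i - \<alpha> i)\<^sup>2)"
  have \<phi>lim: "(\<lambda>n. \<phi> (p n)) \<longlonglongrightarrow> m"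
  proof (rule tendsto_sandwich)
    show "\<forall>\<^sub>F n in sequentially. m \<le> \<phi> (p n)" using m p(1) by simp
    show "\<forall>\<^sub>F n in sequentially. \<phi> (p n) \<le> m + 1 / real (Suc n)" using p(2) by (simp add: less_imp_le)
    show "(\<lambda>n. m + 1 / real (Suc n)) \<longlonglongrightarrow> m"
      using tendsto_add[OF tendsto_const LIMSEQ_Suc[OF lim_inverse_n']] by fastforce
  qed simp
  have Slim: "(\<lambda>n. (\<Sum>i\<in>I. (l i (p n) - \<alpha> i)\<^sup>2)) \<longlonglongrightarrow> S"
    unfolding S_def by (intro tendsto_intros L)
  have "(\<lambda>n. \<phi> (p n) - c * (\<Sum>i\<in>I. (l i (p n) - \<alpha> i)\<^sup>2)) \<longlonglongrightarrow> m - c * S"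
    by (intro tendsto_intros \<phi>lim Slim)
  then have Glim: "(\<lambda>n. G (p n)) \<longlonglongrightarrow> m - c * S" by (simp add: \<phi>_def)
  show thesis
  proof (rule that[of "\<lambda>i. 2 * c * (L i - \<alpha> i)"])
    fix x assume x: "x \<in> D"
    define U where "U = (\<Sum>i\<in>I. (L i - \<alpha> i) * (l i x - L i))"
    define V where "V = (\<Sum>i\<in>I. (l i x - L i)\<^sup>2)"
    \<comment> \<open>Compare \<open>m\<close> with the value of \<open>\<phi>\<close> between
      \<open>p n\<close> and \<open>x\<close>, let \<open>n\<close> tend to infinity, and expand in
      \<open>t\<close>.\<close>
    have "0 \<le> t * (G x - (m - c * S) + 2 * c * U) + t\<^sup>2 * (c * V)" if t: "0 < t" "t \<le> 1" for t
    proof -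
      have "m \<le> (1 - t) * G (p n) + t * G x + c * (\<Sum>i\<in>I. ((l i (p n) - \<alpha> i) + t * (l i x - l i (p n)))\<^sup>2)" for n
        using order_trans[OF m[OF comb_in[OF p(1) x]] comb[OF p(1) x]] t by simp
      moreover have "(\<lambda>n. (1 - t) * G (p n) + t * G x + c * (\<Sum>i\<in>I. ((l i (p n) - \<alpha> i) + t * (l i x - l i (p n)))\<^sup>2))
         \<longlonglongrightarrow> (1 - t) * (m - c * S) + t * G x + c * (\<Sum>i\<in>I. ((L i - \<alpha> i) + t * (l i x - L i))\<^sup>2)"
        by (intro tendsto_intros Glim L)
      ultimately have "m \<le> (1 - t) * (m - c * S) + t * G x + c * (\<Sum>i\<in>I. ((L i - \<alpha> i) + t * (l i x - L i))\<^sup>2)"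
        by (intro LIMSEQ_le_const) auto
      also have "(\<Sum>i\<in>I. ((L i - \<alpha> i) + t * (l i x - L i))\<^sup>2) = S + 2 * t * U + t\<^sup>2 * V"
        unfolding S_def U_def V_def sum_distrib_left sum.distrib[symmetric]
        by (intro sum.cong refl) (simp add: power2_eq_square algebra_simps)
      finally show ?thesis by (simp add: algebra_simps)
    qed
    then have "0 \<le> G x - (m - c * S) + 2 * c * U" by (rule nonneg_of_quadratic_nonneg)
    \<comment> \<open>Measuring from \<open>\<alpha>\<close> instead of \<open>L\<close> adds
      \<open>2 * c * S\<close>; this offsets the \<open>- c * S\<close> in the limit of
      \<open>G\<close> and leaves a nonnegative surplus.\<close>
    moreover have "(\<Sum>i\<in>I. 2 * c * (L i - \<alpha> i) * (l i x - \<alpha> i)) = 2 * c * (U + S)"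
    proof -
      have "U + S = (\<Sum>i\<in>I. (L i - \<alpha> i) * (l i x - \<alpha> i))"
        unfolding U_def S_def sum.distrib[symmetric]
        by (intro sum.cong refl) (simp add: power2_eq_square algebra_simps)
      then show ?thesis by (simp add: sum_distrib_left mult.assoc)
    qed
    moreover have "0 \<le> c * S" using assms(5) by (simp add: S_def sum_nonneg)
    ultimately show "\<beta> \<le> G x + (\<Sum>i\<in>I. 2 * c * (L i - \<alpha> i) * (l i x - \<alpha> i))"
      using \<beta>m by (simp add: algebra_simps)
  qed
qed

text \<open>The form of biconjugation used below: minorants with slope in X reach every level below
  \<open>g q\<close>. If the minorant at hand is too low at \<open>q\<close>, a penalty multiplier
  supplies a better one.\<close>

lemma weak_star_lsc_affine_minorant:
  fixes g :: "('a::real_normed_vector \<Rightarrow>\<^sub>L real) \<Rightarrow> ereal"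
  assumes "proper_fun g" "convex_efun g" "weak_star_lsc g"
    and minor: "\<And>p. ereal (blinfun_apply p x0 - k) \<le> g p"
    and r: "ereal r < g q"
  obtains x where "\<And>p. ereal (r + blinfun_apply (p - q) x) \<le> g p"
proof (cases "r \<le> blinfun_apply q x0 - k")
  case True
  have "ereal (r + blinfun_apply (p - q) x0) \<le> g p" for p
    by (rule order_trans[OF _ minor[of p]]) (use True in \<open>simp add: blinfun.diff_left\<close>)
  then show thesis by (rule that)
next
  case False
  \<comment> \<open>The slack \<open>r1 - r\<close> absorbs the variation of \<open>p x0\<close>
    near \<open>q\<close>; for this \<open>x0\<close> joins the finite set and \<open>e\<close> is
    at most the slack.\<close>
  obtain r1 where r1: "ereal r < ereal r1" "ereal r1 < g q"
    using r by (metis ereal_dense2)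
  have "weak_star_open (- {q. g q \<le> ereal r1})" using assms(3) by (simp add: weak_star_lsc_def)
  then obtain F0 e0 where F0: "finite F0" "e0 > 0"
      "{p. \<forall>x\<in>F0. \<bar>blinfun_apply p x - blinfun_apply q x\<bar> < e0} \<subseteq> - {q. g q \<le> ereal r1}"
    using bspec[OF iffD1[OF weak_star_open_def], of "- {q. g q \<le> ereal r1}" q] r1(2)
    by (auto simp: not_le)
  define F where "F = insert x0 F0"
  define e where "e = min e0 (r1 - r)"
  have F: "finite F" "x0 \<in> F" and e: "e > 0" using F0 r1 by (auto simp: F_def e_def)
  \<comment> \<open>Subtracting the given minorant makes \<open>G\<close> nonnegative, so that a large penalty outside the
    weak-star neighbourhood of \<open>q\<close> dominates \<open>\<beta>\<close>.\<close>
  define \<beta> where "\<beta> = r - blinfun_apply q x0 + k"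
  have \<beta>: "\<beta> > 0" using False by (simp add: \<beta>_def)
  define G where "G = (\<lambda>p. real_of_ereal (g p) - blinfun_apply p x0 + k)"
  have fin: "g p = ereal (real_of_ereal (g p))" if "p \<in> edom g" for p
    using that assms(1) by (cases "g p") (auto simp: edom_def proper_fun_def)
  have le: "real_of_ereal (g ((1 - t) *\<^sub>R p + t *\<^sub>R p')) \<le> (1 - t) * real_of_ereal (g p) + t * real_of_ereal (g p')"
    and in_edom: "(1 - t) *\<^sub>R p + t *\<^sub>R p' \<in> edom g"
    if "p \<in> edom g" "p' \<in> edom g" "0 \<le> t" "t \<le> 1" for p p' t
  proof -
    have *: "g ((1 - t) *\<^sub>R p + t *\<^sub>R p') \<le> ereal ((1 - t) * real_of_ereal (g p) + t * real_of_ereal (g p'))"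
      by (rule convex_efun_le[OF assms(2)]) (use fin[OF that(1)] fin[OF that(2)] that in auto)
    then show in_edom: "(1 - t) *\<^sub>R p + t *\<^sub>R p' \<in> edom g" unfolding edom_le_real by (rule exI)
    from * show "real_of_ereal (g ((1 - t) *\<^sub>R p + t *\<^sub>R p')) \<le> (1 - t) * real_of_ereal (g p) + t * real_of_ereal (g p')"
      by (subst (asm) fin[OF in_edom]) simp
  qed
  have D: "convex (edom g)"
    unfolding convex_alt using in_edom by blast
  have cvx: "convex_on (edom g) G"
  proof (rule convex_onI[OF _ D])
    fix t :: real and p p' assume t: "0 < t" "t < 1" "p \<in> edom g" "p' \<in> edom g"
    then show "G ((1 - t) *\<^sub>R p + t *\<^sub>R p') \<le> (1 - t) * G p + t * G p'"
      using le[of p p' t] unfolding G_def blinfun.add_left blinfun.scaleR_left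
      by (simp add: right_diff_distrib distrib_left left_diff_distrib)
  qed
  have G0: "0 \<le> G p" if "p \<in> edom g" for p
  proof -
    have "ereal (blinfun_apply p x0 - k) \<le> ereal (real_of_ereal (g p))"
      unfolding fin[OF that, symmetric] by (rule minor)
    then show ?thesis by (simp add: G_def)
  qed
  \<comment> \<open>Outside the neighbourhood some coordinate deviates by at least \<open>e\<close>,
    so the coefficient \<open>\<beta> / e\<^sup>2\<close> lifts the penalty alone to
    \<open>\<beta>\<close>.\<close>
  have bound: "\<beta> \<le> G p + \<beta> / e\<^sup>2 * (\<Sum>x\<in>F. (blinfun_apply p x - blinfun_apply q x)\<^sup>2)" if p: "p \<in> edom g" for p
  proof (cases "\<forall>x\<in>F. \<bar>blinfun_apply p x - blinfun_apply q x\<bar> < e")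
    case True
    then have "\<not> g p \<le> ereal r1" using F0(3) by (auto simp: F_def e_def)
    then have "ereal r1 < ereal (real_of_ereal (g p))" unfolding fin[OF p, symmetric] by simp
    then have "r1 < real_of_ereal (g p)" by simp
    moreover have "\<bar>blinfun_apply p x0 - blinfun_apply q x0\<bar> < r1 - r" using True F(2) by (auto simp: e_def)
    ultimately have "\<beta> \<le> G p" by (simp add: G_def \<beta>_def)
    moreover have "0 \<le> \<beta> / e\<^sup>2 * (\<Sum>x\<in>F. (blinfun_apply p x - blinfun_apply q x)\<^sup>2)"
      using \<beta> by (intro mult_nonneg_nonneg sum_nonneg) auto
    ultimately show ?thesis by linarith
  next
    case False
    then obtain x where x: "x \<in> F" "e \<le> \<bar>blinfun_apply p x - blinfun_apply q x\<bar>" by force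
    have "e\<^sup>2 \<le> (blinfun_apply p x - blinfun_apply q x)\<^sup>2" using x(2) e by (simp add: abs_le_square_iff[symmetric])
    also have "\<dots> \<le> (\<Sum>x\<in>F. (blinfun_apply p x - blinfun_apply q x)\<^sup>2)"
      using x(1) F by (intro member_le_sum) auto
    finally have "\<beta> / e\<^sup>2 * e\<^sup>2 \<le> \<beta> / e\<^sup>2 * (\<Sum>x\<in>F. (blinfun_apply p x - blinfun_apply q x)\<^sup>2)"
      using \<beta> by (intro mult_left_mono) auto
    then show ?thesis using e G0[OF p] by simp
  qed
  have ne: "edom g \<noteq> {}" using assms(1) by (auto simp: proper_fun_def edom_def)
  have pos: "\<beta> / e\<^sup>2 > 0" using \<beta> e by simp
  have lin: "linear (\<lambda>p::'a \<Rightarrow>\<^sub>L real. blinfun_apply p x)" for x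
    by (rule linearI) (simp_all add: blinfun.add_left blinfun.scaleR_left)
  obtain w where w: "\<And>p. p \<in> edom g \<Longrightarrow> \<beta> \<le> G p + (\<Sum>x\<in>F. w x * (blinfun_apply p x - blinfun_apply q x))"
    by (rule convex_penalty_multiplier[OF cvx ne F(1) lin pos bound]) auto
  show thesis
  \<comment> \<open>\<open>x0\<close> restores the minorant subtracted in \<open>G\<close>; the
    multiplier changes sign on moving to the other side.\<close>
  proof (rule that[of "x0 - (\<Sum>x\<in>F. w x *\<^sub>R x)"])
    fix p
    show "ereal (r + blinfun_apply (p - q) (x0 - (\<Sum>x\<in>F. w x *\<^sub>R x))) \<le> g p"
    proof (cases "p \<in> edom g")
      case True
      have "blinfun_apply (p - q) (\<Sum>x\<in>F. w x *\<^sub>R x) = (\<Sum>x\<in>F. w x * (blinfun_apply p x - blinfun_apply q x))"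
        by (simp add: blinfun.sum_right blinfun.scaleR_right blinfun.diff_left)
      then have "r + blinfun_apply (p - q) (x0 - (\<Sum>x\<in>F. w x *\<^sub>R x)) \<le> real_of_ereal (g p)"
        using w[OF True] by (simp add: G_def \<beta>_def blinfun.diff_right) (simp add: blinfun.diff_left)
      then show ?thesis by (subst fin[OF True]) simp
    qed (simp add: edom_def)
  qed
qed

subsection \<open>Conjugates and chain functions\<close>

lemma norm_lsc_SUP:
  assumes "\<And>i. i \<in> I \<Longrightarrow> norm_lsc (\<phi> i)"
  shows "norm_lsc (\<lambda>x. SUP i\<in>I. \<phi> i x)"
proof -
  have "{x. (SUP i\<in>I. \<phi> i x) \<le> ereal c} = (\<Inter>i\<in>I. {x. \<phi> i x \<le> ereal c})" for c
    by (auto simp: SUP_le_iff)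
  then show ?thesis using assms by (auto simp: norm_lsc_def)
qed

lemma convex_efun_SUP:
  assumes "\<And>i. i \<in> I \<Longrightarrow> convex_efun (\<phi> i)"
  shows "convex_efun (\<lambda>x. SUP i\<in>I. \<phi> i x)"
  unfolding convex_efun_def
proof (intro allI impI SUP_least)
  fix x y i and t :: real assume t: "0 < t \<and> t < 1" and i: "i \<in> I"
  have "\<phi> i (t *\<^sub>R x + (1 - t) *\<^sub>R y) \<le> ereal t * \<phi> i x + ereal (1 - t) * \<phi> i y"
    using assms[OF i] t unfolding convex_efun_def by blast
  also have "\<dots> \<le> ereal t * (SUP i\<in>I. \<phi> i x) + ereal (1 - t) * (SUP i\<in>I. \<phi> i y)"
    using t i by (intro add_mono ereal_mult_left_mono SUP_upper) auto
  finally show "\<phi> i (t *\<^sub>R x + (1 - t) *\<^sub>R y)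
      \<le> ereal t * (SUP i\<in>I. \<phi> i x) + ereal (1 - t) * (SUP i\<in>I. \<phi> i y)" .
qed

lemma norm_lsc_affine:
  "norm_lsc (\<lambda>x. ereal (blinfun_apply \<xi> x + k))"
  unfolding norm_lsc_def by (auto intro!: closed_Collect_le continuous_intros)

lemma convex_efun_affine:
  "convex_efun (\<lambda>x. ereal (blinfun_apply \<xi> x + k))"
  unfolding convex_efun_def blinfun.add_right blinfun.scaleR_right by (simp add: algebra_simps)

text \<open>Basic weak-star neighbourhoods are finite intersections of norm-open sets.\<close>

lemma norm_lsc_weak_star_lsc:
  assumes "weak_star_lsc g"
  shows "norm_lsc g"
proof -
  have "open U" if U: "weak_star_open U" for U :: "('a \<Rightarrow>\<^sub>L real) set"
    unfolding open_subopen[of U]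
  proof (intro ballI)
    fix p assume "p \<in> U"
    then obtain F e where F: "finite F" "e > 0" "{q. \<forall>x\<in>F. \<bar>blinfun_apply q x - blinfun_apply p x\<bar> < e} \<subseteq> U"
      using bspec[OF iffD1[OF weak_star_open_def U]] by blast
    have "{q. \<forall>x\<in>F. \<bar>blinfun_apply q x - blinfun_apply p x\<bar> < e}
        = (\<Inter>x\<in>F. {q. \<bar>blinfun_apply q x - blinfun_apply p x\<bar> < e})" by auto
    also have "open \<dots>"
      using F(1) by (intro open_INT ballI open_Collect_less continuous_intros)
    finally have "open {q. \<forall>x\<in>F. \<bar>blinfun_apply q x - blinfun_apply p x\<bar> < e}" .
    then show "\<exists>V. open V \<and> p \<in> V \<and> V \<subseteq> U"
      using F by (intro exI[of _ "{q. \<forall>x\<in>F. \<bar>blinfun_apply q x - blinfun_apply p x\<bar> < e}"]) auto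
  qed
  then show ?thesis using assms unfolding weak_star_lsc_def norm_lsc_def closed_def by blast
qed

section \<open>Conjugates on X\<close>

text \<open>The canonical embedding of X into its bidual.\<close>

definition eval_functional :: "'a::real_normed_vector \<Rightarrow> (('a \<Rightarrow>\<^sub>L real) \<Rightarrow>\<^sub>L real)" where
  "eval_functional x = Blinfun (\<lambda>p. blinfun_apply p x)"

lemma eval_functional_apply [simp]: "blinfun_apply (eval_functional x) p = blinfun_apply p x"
  unfolding eval_functional_def by (simp add: bounded_linear_Blinfun_apply blinfun.bounded_linear_left)

lemma subdiff_X_subgradient:
  assumes "proper_fun g" "x \<in> subdiff_X g p"
  shows "subgradient g p (eval_functional x)"
proof -
  have "g p \<noteq> - \<infinity>" "g p < \<infinity>" using assms by (auto simp: proper_fun_def subdiff_X_def)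
  then obtain \<gamma> where \<gamma>: "g p = ereal \<gamma>" by (cases "g p") auto
  have "ereal \<gamma> + ereal (blinfun_apply (q - p) x) \<le> g q" for q
  proof -
    have "ereal (blinfun_apply (q - p) x) \<le> g q - ereal \<gamma>"
      using assms(2) \<gamma> by (auto simp: subdiff_X_def)
    then show ?thesis by (cases "g q") auto
  qed
  then show ?thesis by (simp add: subgradient_def \<gamma>)
qed

lemma conj_X_ge: "ereal (blinfun_apply q x) - g q \<le> conj_X g x"
  unfolding conj_X_def by (rule SUP_upper) simp

text \<open>Fenchel's equality: the subgradient inequality says that the supremum is attained at
  \<open>p\<close>.\<close>

lemma conj_X_eq_subgradient:
  assumes "subgradient g p (eval_functional x)" "g p = ereal \<gamma>"
  shows "conj_X g x = ereal (blinfun_apply p x - \<gamma>)"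
proof (rule antisym)
  show "conj_X g x \<le> ereal (blinfun_apply p x - \<gamma>)"
    unfolding conj_X_def
  proof (rule SUP_least)
    fix q
    have "ereal \<gamma> + ereal (blinfun_apply (q - p) x) \<le> g q"
      using assms unfolding subgradient_def by auto
    then show "ereal (blinfun_apply q x) - g q \<le> ereal (blinfun_apply p x - \<gamma>)"
      by (cases "g q") (auto simp: blinfun.diff_left)
  qed
  show "ereal (blinfun_apply p x - \<gamma>) \<le> conj_X g x"
    using conj_X_ge[of p x g] assms(2) by simp
qed

text \<open>Conjugation exchanges points and slopes, so density of the image of \<open>T\<close>
  becomes density of base points in X.\<close>

lemma subgradient_conj_X:
  assumes "subgradient g p (eval_functional x)"
  shows "subgradient (conj_X g) x p"
proof -
  obtain \<gamma> where \<gamma>: "g p = ereal \<gamma>" using assms by (rule subgradient_finiteE)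
  have "ereal (blinfun_apply p x - \<gamma>) + ereal (blinfun_apply p (y - x)) \<le> conj_X g y" for y
    using conj_X_ge[of p y g] by (simp add: \<gamma> blinfun.diff_right)
  then show ?thesis unfolding subgradient_def conj_X_eq_subgradient[OF assms \<gamma>] by simp
qed

lemma conj_X_convex_lsc:
  assumes "\<And>p. g p \<noteq> - \<infinity>"
  shows "convex_efun (conj_X g)" "norm_lsc (conj_X g)"
proof -
  define k where "k = (\<lambda>q. real_of_ereal (g q))"
  \<comment> \<open>Terms outside \<open>edom g\<close> are minus infinity; the others are
    continuous affine functions.\<close>
  have "conj_X g = (\<lambda>x. SUP q\<in>edom g. ereal (blinfun_apply q x + (- k q)))"
  proof (rule ext, rule antisym)
    fix x
    have fin: "g q = ereal (k q)" if "q \<in> edom g" for q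
      using that assms[of q] by (cases "g q") (auto simp: edom_def k_def)
    show "conj_X g x \<le> (SUP q\<in>edom g. ereal (blinfun_apply q x + (- k q)))"
      unfolding conj_X_def
    proof (rule SUP_least)
      fix q
      show "ereal (blinfun_apply q x) - g q \<le> (SUP q\<in>edom g. ereal (blinfun_apply q x + (- k q)))"
      proof (cases "q \<in> edom g")
        case True
        have "ereal (blinfun_apply q x) - g q = ereal (blinfun_apply q x + (- k q))"
          by (simp add: fin[OF True])
        also have "\<dots> \<le> (SUP q\<in>edom g. ereal (blinfun_apply q x + (- k q)))"
          using True by (rule SUP_upper)
        finally show ?thesis .
      qed (simp add: edom_def)
    qed
    show "(SUP q\<in>edom g. ereal (blinfun_apply q x + (- k q))) \<le> conj_X g x"
    proof (rule SUP_least)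
      fix q assume "q \<in> edom g"
      then show "ereal (blinfun_apply q x + (- k q)) \<le> conj_X g x"
        using conj_X_ge[of q x g] fin[of q] by simp
    qed
  qed
  then show "convex_efun (conj_X g)" "norm_lsc (conj_X g)"
    by (simp_all only: convex_efun_SUP convex_efun_affine norm_lsc_SUP norm_lsc_affine)
qed

section \<open>Chain functions\<close>

text \<open>An index set for the supremum that is independent of the endpoint: each chain
  contributes one affine function of it.\<close>

definition chains ::
  "(('a::real_normed_vector \<Rightarrow>\<^sub>L real) \<Rightarrow> 'a set) \<Rightarrow> ('a \<Rightarrow>\<^sub>L real)
    \<Rightarrow> (nat \<times> (nat \<Rightarrow> 'a \<Rightarrow>\<^sub>L real) \<times> (nat \<Rightarrow> 'a)) set" where
  "chains T p0 = {(n, ps, xs). ps 0 = p0 \<and> (\<forall>i\<le>n. xs i \<in> T (ps i))}"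

lemma chain_fun_eq_SUP:
  "chain_fun T p0 p = (SUP (n, ps, xs)\<in>chains T p0.
     ereal ((\<Sum>i<n. blinfun_apply (ps (Suc i) - ps i) (xs i)) + blinfun_apply (p - ps n) (xs n)))"
  unfolding chain_fun_def chains_def by (rule arg_cong[of _ _ Sup]) (auto simp: image_iff; blast)

lemma chain_fun_ge:
  assumes "ps 0 = p0" "\<And>i. i \<le> n \<Longrightarrow> xs i \<in> T (ps i)"
  shows "ereal ((\<Sum>i<n. blinfun_apply (ps (Suc i) - ps i) (xs i)) + blinfun_apply (p - ps n) (xs n))
      \<le> chain_fun T p0 p"
  unfolding chain_fun_def using assms by (intro Sup_upper) blast

lemma chain_fun_convex_lsc:
  "convex_efun (chain_fun T p0)" "norm_lsc (chain_fun T p0)"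
proof -
  define k where "k = (\<lambda>(n, ps :: nat \<Rightarrow> 'a \<Rightarrow>\<^sub>L real, xs :: nat \<Rightarrow> 'a).
      (\<Sum>i<n. blinfun_apply (ps (Suc i) - ps i) (xs i)) - blinfun_apply (ps n) (xs n))"
  define x where "x = (\<lambda>(n, ps :: nat \<Rightarrow> 'a \<Rightarrow>\<^sub>L real, xs :: nat \<Rightarrow> 'a). xs (n :: nat))"
  have "chain_fun T p0 = (\<lambda>p. SUP c\<in>chains T p0. ereal (blinfun_apply (eval_functional (x c)) p + k c))"
    by (rule ext, unfold chain_fun_eq_SUP, rule SUP_cong)
       (auto simp: k_def x_def blinfun.diff_left)
  then show "convex_efun (chain_fun T p0)" "norm_lsc (chain_fun T p0)"
    by (simp_all only: convex_efun_SUP convex_efun_affine norm_lsc_SUP norm_lsc_affine)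
qed

lemma chain_fun_extend:
  assumes "x \<in> T p"
  shows "chain_fun T p0 p + ereal (blinfun_apply (q - p) x) \<le> chain_fun T p0 q"
proof -
  \<comment> \<open>With the real term on the right, the claim bounds a supremum and can be checked
    chain by chain, each prolonged by the link \<open>(p, x)\<close>.\<close>
  have "chain_fun T p0 p \<le> chain_fun T p0 q - ereal (blinfun_apply (q - p) x)"
    unfolding chain_fun_eq_SUP[of T p0 p]
  proof (rule SUP_least, clarify)
    fix n ps xs assume "(n, ps, xs) \<in> chains T p0"
    then have c: "ps 0 = p0" "\<And>i. i \<le> n \<Longrightarrow> xs i \<in> T (ps i)" by (auto simp: chains_def)
    define ps' xs' where "ps' = ps(Suc n := p)" and "xs' = xs(Suc n := x)"
    have "ereal ((\<Sum>i<Suc n. blinfun_apply (ps' (Suc i) - ps' i) (xs' i))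
        + blinfun_apply (q - ps' (Suc n)) (xs' (Suc n))) \<le> chain_fun T p0 q"
      using c assms by (intro chain_fun_ge) (auto simp: ps'_def xs'_def le_Suc_eq)
    moreover have "(\<Sum>i<n. blinfun_apply (ps' (Suc i) - ps' i) (xs' i))
        = (\<Sum>i<n. blinfun_apply (ps (Suc i) - ps i) (xs i))"
      by (intro sum.cong refl) (auto simp: ps'_def xs'_def)
    ultimately have "ereal ((\<Sum>i<n. blinfun_apply (ps (Suc i) - ps i) (xs i)) + blinfun_apply (p - ps n) (xs n)
        + blinfun_apply (q - p) x) \<le> chain_fun T p0 q"
      by (simp add: ps'_def xs'_def)
    then show "ereal ((\<Sum>i<n. blinfun_apply (ps (Suc i) - ps i) (xs i)) + blinfun_apply (p - ps n) (xs n))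
        \<le> chain_fun T p0 q - ereal (blinfun_apply (q - p) x)"
      by (cases "chain_fun T p0 q") auto
  qed
  then show ?thesis by (cases "chain_fun T p0 q"; cases "chain_fun T p0 p") auto
qed

text \<open>Each link is at most the corresponding increment of \<open>g\<close>, and the increments
  telescope.\<close>

lemma chain_fun_le:
  assumes "proper_fun g" "\<And>p. T p \<subseteq> subdiff_X g p" "g p0 = ereal \<gamma>"
  shows "chain_fun T p0 p \<le> g p - ereal \<gamma>"
  unfolding chain_fun_eq_SUP
proof (rule SUP_least, clarify)
  fix n ps xs assume "(n, ps, xs) \<in> chains T p0"
  then have c: "ps 0 = p0" "\<And>i. i \<le> n \<Longrightarrow> subgradient g (ps i) (eval_functional (xs i))"
    using subdiff_X_subgradient[OF assms(1)] assms(2) by (fastforce simp: chains_def)+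
  define G where "G = (\<lambda>i. real_of_ereal (g (ps i)))"
  have G: "g (ps i) = ereal (G i)" if "i \<le> n" for i
    using c(2)[OF that] by (auto simp: G_def subgradient_def ereal_real')
  have "(\<Sum>i<j. blinfun_apply (ps (Suc i) - ps i) (xs i)) \<le> G j - \<gamma>" if "j \<le> n" for j
    using that
  proof (induction j)
    case (Suc j)
    then show ?case using subgradientD[OF c(2) G G, of j "Suc j"] by simp
  qed (use G[of 0] c(1) assms(3) in simp)
  then have *: "(\<Sum>i<n. blinfun_apply (ps (Suc i) - ps i) (xs i)) \<le> G n - \<gamma>" by simp
  have "g (ps n) + ereal (blinfun_apply (p - ps n) (xs n)) \<le> g p"
    using c(2)[of n] by (simp add: subgradient_def)
  then show "ereal ((\<Sum>i<n. blinfun_apply (ps (Suc i) - ps i) (xs i)) + blinfun_apply (p - ps n) (xs n))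
      \<le> g p - ereal \<gamma>"
    using * G[of n] by (cases "g p") auto
qed

theorem mainTheorem11:
  fixes g :: "('a::banach \<Rightarrow>\<^sub>L real) \<Rightarrow> ereal"
    and T :: "('a \<Rightarrow>\<^sub>L real) \<Rightarrow> 'a set"
    and p0 :: "'a \<Rightarrow>\<^sub>L real"
  assumes "proper_fun g" and "convex_efun g" and "weak_star_lsc g"
    and "\<And>p. T p \<subseteq> subdiff_X g p"
    and "p0 \<in> opdom T"
  shows "(interior (edom g) \<noteq> {} \<and> interior (edom g) \<subseteq> closure (opdom T)
           \<longrightarrow> (\<forall>p\<in>edom g. g p - g p0 = chain_fun T p0 p))
       \<and> (interior (edom (conj_X g)) \<noteq> {} \<and> interior (edom (conj_X g)) \<subseteq> closure (\<Union>p. T p)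
           \<longrightarrow> (\<forall>p. g p - g p0 = chain_fun T p0 p))"
proof -
  define h where "h = chain_fun T p0"
  obtain x0 where x0: "x0 \<in> T p0" using assms(5) by (auto simp: opdom_def)
  have gsub: "subgradient g p (eval_functional x)" if "x \<in> T p" for p x
    using subdiff_X_subgradient[OF assms(1)] assms(4) that by blast
  obtain \<gamma> where \<gamma>: "g p0 = ereal \<gamma>" by (rule subgradient_finiteE[OF gsub[OF x0]]) blast
  have g_lsc: "norm_lsc g" by (rule norm_lsc_weak_star_lsc[OF assms(3)])
  have g_inf: "g p \<noteq> - \<infinity>" for p using assms(1) by (simp add: proper_fun_def)
  have h_le: "h p \<le> g p - ereal \<gamma>" for p
    unfolding h_def by (rule chain_fun_le[OF assms(1,4) \<gamma>])
  \<comment> \<open>The chain with \<open>n = 0\<close>; together with \<open>h_le\<close> it gives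
    \<open>h p0 = 0\<close>, which identifies the constants below.\<close>
  have h_ge: "ereal (blinfun_apply (p - p0) x0) \<le> h p" for p
    using chain_fun_ge[of "\<lambda>_. p0" p0 0 "\<lambda>_. x0" T p] x0 by (simp add: h_def)
  have h_inf: "h p \<noteq> - \<infinity>" for p using h_ge[of p] by auto
  have h0: "h p0 = ereal 0"
    using h_ge[of p0] h_le[of p0] \<gamma> by (simp add: blinfun.zero_left zero_ereal_def antisym)
  have hsub: "subgradient h p (eval_functional x)" if x: "x \<in> T p" for p x
  proof -
    obtain a where "g p = ereal a" by (rule subgradient_finiteE[OF gsub[OF x]]) blast
    then have "\<bar>h p\<bar> \<noteq> \<infinity>" using h_le[of p] h_inf[of p] by auto
    then show ?thesis
      using chain_fun_extend[of x T p p0] x by (simp add: subgradient_def h_def)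
  qed
  have h_convex: "convex_efun h" and h_lsc: "norm_lsc h"
    unfolding h_def by (fact chain_fun_convex_lsc)+
  have "g p - g p0 = chain_fun T p0 p"
    if i: "interior (edom g) \<noteq> {} \<and> interior (edom g) \<subseteq> closure (opdom T)" and p: "p \<in> edom g" for p
  proof -
    define R where "R = {(p, eval_functional x) | p x. x \<in> T p}"
    have R: "fst ` R = opdom T" by (force simp: R_def opdom_def)
    obtain c where c: "\<And>a. a \<in> edom g \<Longrightarrow> h a = g a + ereal c"
    proof (rule common_subgradients_differ_by_constant[of g h R])
      show "interior (edom g) \<subseteq> closure (fst ` R)" using i R by simp
    qed (use assms i g_inf h_inf h_convex h_lsc gsub hsub g_lsc in \<open>auto simp: R_def\<close>)
    have "h p0 = g p0 + ereal c" using \<gamma> by (intro c) (simp add: edom_def)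
    then have "c = - \<gamma>" using h0 \<gamma> by simp
    then show ?thesis using c[OF p] \<gamma> by (simp add: h_def minus_ereal_def)
  qed
  moreover have "g q - g p0 = chain_fun T p0 q"
    if ii: "interior (edom (conj_X g)) \<noteq> {} \<and> interior (edom (conj_X g)) \<subseteq> closure (\<Union>p. T p)" for q
  proof -
    let ?f = "conj_X g" and ?k = "conj_X h"
    \<comment> \<open>The pairs are reversed: points of X are base points and functionals are
      slopes.\<close>
    define R where "R = {(x, p) | p x. x \<in> T p}"
    have R: "fst ` R = (\<Union>p. T p)" by (force simp: R_def)
    have f_x0: "?f x0 = ereal (blinfun_apply p0 x0 - \<gamma>)"
      by (rule conj_X_eq_subgradient[OF gsub[OF x0] \<gamma>])
    have k_x0: "?k x0 = ereal (blinfun_apply p0 x0)"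
      using conj_X_eq_subgradient[OF hsub[OF x0] h0] by simp
    have f_inf: "?f x \<noteq> - \<infinity>" and k_inf: "?k x \<noteq> - \<infinity>" for x
      using conj_X_ge[of p0 x g] conj_X_ge[of p0 x h] \<gamma> h0 by auto
    obtain c where c: "\<And>a. a \<in> edom ?f \<Longrightarrow> ?k a = ?f a + ereal c"
    proof (rule common_subgradients_differ_by_constant[of ?f ?k R])
      show "interior (edom ?f) \<subseteq> closure (fst ` R)" using ii R by simp
    qed (use ii f_inf k_inf conj_X_convex_lsc[of g, OF g_inf] conj_X_convex_lsc[of h, OF h_inf]
           subgradient_conj_X[OF gsub] subgradient_conj_X[OF hsub] in \<open>auto simp: R_def\<close>)
    have "?k x0 = ?f x0 + ereal c" by (rule c) (simp add: edom_def f_x0)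
    then have c_eq: "c = \<gamma>" by (simp add: f_x0 k_x0)
    \<comment> \<open>If \<open>\<rho>\<close> lies strictly between, a minorant of \<open>g\<close>
      with value \<open>\<rho> + \<gamma>\<close> at \<open>q\<close> has a slope \<open>x\<close>
      where the conjugate of \<open>g\<close> is finite. There the conjugates differ by
      \<open>\<gamma>\<close>, so the Fenchel-Young inequality for \<open>h\<close> forces
      \<open>h q \<ge> \<rho>\<close>.\<close>
    have "g q - ereal \<gamma> \<le> h q"
    proof (rule ccontr)
      assume "\<not> g q - ereal \<gamma> \<le> h q"
      then have "h q < g q - ereal \<gamma>" by simp
      then obtain \<rho> where \<rho>: "h q < ereal \<rho>" "ereal \<rho> < g q - ereal \<gamma>" by (metis ereal_dense2)
      have r: "ereal (\<rho> + \<gamma>) < g q" using \<rho>(2) g_inf[of q] by (cases "g q") auto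
      \<comment> \<open>The initial minorant is the subgradient inequality at
        \<open>p0\<close>.\<close>
      have minor: "ereal (blinfun_apply p x0 - (blinfun_apply p0 x0 - \<gamma>)) \<le> g p" for p
        using gsub[OF x0] by (simp add: subgradient_def \<gamma> blinfun.diff_left) (metis add.commute diff_add_eq diff_diff_eq2)
      obtain x where x: "\<And>p. ereal (\<rho> + \<gamma> + blinfun_apply (p - q) x) \<le> g p"
        by (rule weak_star_lsc_affine_minorant[OF assms(1-3) minor r]) blast
      have "?f x \<le> ereal (blinfun_apply q x - (\<rho> + \<gamma>))"
        unfolding conj_X_def
      proof (rule SUP_least)
        fix p
        show "ereal (blinfun_apply p x) - g p \<le> ereal (blinfun_apply q x - (\<rho> + \<gamma>))"
          using x[of p] by (cases "g p") (auto simp: blinfun.diff_left)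
      qed
      moreover from this obtain fx where fx: "?f x = ereal fx"
        using f_inf[of x] by (cases "?f x") auto
      ultimately have "fx + \<gamma> \<le> blinfun_apply q x - \<rho>" by simp
      moreover have "?k x = ereal (fx + \<gamma>)" using c[of x] by (simp add: edom_def fx c_eq)
      moreover have "ereal (blinfun_apply q x) - h q \<le> ?k x" by (rule conj_X_ge)
      ultimately show False using \<rho>(1) h_inf[of q] by (cases "h q") auto
    qed
    then show ?thesis using h_le[of q] \<gamma> by (simp add: h_def)
  qed
  ultimately show ?thesis by blast
qed

end
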